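(* For all $n \in \mathbb{N}$, $$\sum_{\mu \in \mathcal{M}_n} H[\mu;q] = R_{\mathcal{I}_n}(q),$$ where $\mathcal{M}_n$ is the set of Motzkin paths of length $n$, $H[\mu;q]$ is the generating function over labelings of $\mu$ defined in the context, and $R_{\mathcal{I}_n}(q)$ is the rank generating function of Bruhat order restricted to the involutions in the symmetric group $\mathfrak{S}_n$.
   Context: Permutations and Bruhat order. $\mathfrak{S}_n$ is the set of permutations of $[n]=\{1,\dots,n\}$. For $\pi\in\mathfrak{S}_n$, $\mathrm{Inv}(\pi)=\{(i,j)\in[n]^2 : i<j,\ \pi(i)>\pi(j)\}$ and $\ell(\pi)=|\mathrm{Inv}(\pi)|$. Bruhat order $(\mathfrak{S}_n,\le)$ is the partial order that is the transitive closure of the relations $\pi \lessdot (i\;j)\pi$ whenever $(i\;j)$ is a transposition with $\ell((i\;j)\pi)=\ell(\pi)+1$. $\mathcal{I}_n=\{\sigma\in\mathfrak{S}_n : \sigma^2=\mathrm{id}\}$ is the set of involutions, with the induced partial order. For $\sigma\in\mathcal{I}_n$ let $c(\sigma)=|\{(i,j)\in[n]\times[n] : i<j=\sigma(i)\}|$ and $\hat\ell(\sigma)=\frac{\ell(\sigma)+c(\sigma)}{2}$. It is known that $(\mathcal{I}_n,\le)$ is a graded poset with rank function $\hat\ell$. For a graded poset $P$ with rank function $r$, the rank generating function is $R_P(q)=\sum_{p\in P}q^{r(p)}$; thus $R_{\mathcal{I}_n}(q)=\sum_{\sigma\in\mathcal{I}_n}q^{\hat\ell(\sigma)}$. Motzkin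 paths. A Motzkin path of length $n$ is a lattice path from $(0,0)$ to $(n,0)$ consisting of up steps $U=(1,1)$, down steps $D=(1,-1)$ and horizontal steps $L=(1,0)$ that does not go below the $x$-axis; write $\mu=\mu_1\cdots\mu_n$ for its sequence of steps. The height $h_i(\mu)$ of the $i$th step is the larger of the $y$-coordinates of its two endpoints. A labeling $\lambda$ of $\mu$ assigns to each $i$ with $\mu_i=D$ an integer $\lambda_i\in\{1,\dots,h_i(\mu)\}$; the pair $(\mu,\lambda)$ is a labeled Motzkin path. Define $$H_i(\mu,\lambda)=\begin{cases}\lambda_i-1 & \mu_i=D\\ h_i(\mu) & \mu_i\ne D\end{cases},\qquad H(\mu,\lambda)=\sum_{i=1}^n H_i(\mu,\lambda),\qquad H[\mu;q]=\sum_{\lambda}q^{H(\mu,\lambda)},$$ where the last sum is over all labelings $\lambda$ of $\mu$. *)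

theory Defs
  imports "HOL-Combinatorics.Permutations" "HOL-Library.FuncSet"
    "HOL-Computational_Algebra.Polynomial"
begin

section \<open>Rank generating functions of graded posets\<close>

text \<open>A poset is given by a carrier \<open>P\<close> and an order \<open>le\<close>, of which only the restriction to
  \<open>P\<close> matters; so passing to a subset of the carrier is passing to the induced order.\<close>

definition poset_minimal :: "'a set \<Rightarrow> ('a \<Rightarrow> 'a \<Rightarrow> bool) \<Rightarrow> 'a \<Rightarrow> bool" where
  "poset_minimal P le x \<longleftrightarrow> x \<in> P \<and> (\<forall>y\<in>P. le y x \<longrightarrow> y = x)"

definition poset_covers :: "'a set \<Rightarrow> ('a \<Rightarrow> 'a \<Rightarrow> bool) \<Rightarrow> 'a \<Rightarrow> 'a \<Rightarrow> bool" where
  "poset_covers P le x y \<longleftrightarrow> x \<in> P \<and> y \<in> P \<and> le x y \<and> x \<noteq> y \<and>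
     (\<forall>z\<in>P. le x z \<and> le z y \<longrightarrow> z = x \<or> z = y)"

definition is_rank_function :: "'a set \<Rightarrow> ('a \<Rightarrow> 'a \<Rightarrow> bool) \<Rightarrow> ('a \<Rightarrow> nat) \<Rightarrow> bool" where
  "is_rank_function P le r \<longleftrightarrow>
     (\<forall>x. poset_minimal P le x \<longrightarrow> r x = 0) \<and>
     (\<forall>x y. poset_covers P le x y \<longrightarrow> r y = r x + 1)"

lemma rank_function_unique:
  assumes fin: "finite P"
    and anti: "\<And>x y. x \<in> P \<Longrightarrow> y \<in> P \<Longrightarrow> le x y \<Longrightarrow> le y x \<Longrightarrow> x = y"
    and trans: "\<And>x y z. x \<in> P \<Longrightarrow> y \<in> P \<Longrightarrow> z \<in> P \<Longrightarrow> le x y \<Longrightarrow> le y z \<Longrightarrow> le x z"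
    and r: "is_rank_function P le r" and s: "is_rank_function P le s" and x: "x \<in> P"
  shows "r x = s x"
proof -
  define R where "R = {(y, z). y \<in> P \<and> z \<in> P \<and> le y z \<and> y \<noteq> z}"
  have "finite R"
    by (rule finite_subset[of _ "P \<times> P"]) (use fin in \<open>auto simp: R_def\<close>)
  have tR: "trans R"
    unfolding R_def by (rule transI) (use anti trans in blast)
  have "acyclic R"
    unfolding acyclic_def trancl_id[OF tR] by (auto simp: R_def)
  have wf: "wf R" and wfc: "wf (R\<inverse>)"
    using \<open>finite R\<close> \<open>acyclic R\<close> by (auto intro: finite_acyclic_wf finite_acyclic_wf_converse)
  show ?thesis
    using wf x
  proof (induction x rule: wf_induct_rule)
    case (less x)
    show ?case
    proof (cases "poset_minimal P le x")
      case True
      then show ?thesis using r s by (simp add: is_rank_function_def)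
    next
      case False
      then obtain y where "y \<in> {y. (y, x) \<in> R}"
        using less.prems by (auto simp: poset_minimal_def R_def)
      then obtain z where z: "(z, x) \<in> R" "\<And>w. (z, w) \<in> R \<Longrightarrow> (w, x) \<notin> R"
        using wfE_min[OF wfc, of y "{y. (y, x) \<in> R}"] by auto
      then have "poset_covers P le z x"
        by (auto simp: poset_covers_def R_def)
      then show ?thesis
        using less.IH[OF z(1)] z(1) r s by (simp add: is_rank_function_def R_def)
    qed
  qed
qed

text \<open>The rank function of a graded poset; on a finite poset its values on \<open>P\<close> are uniquely
  determined by \<open>rank_function_unique\<close>. It is unspecified if \<open>P\<close> is not graded.\<close>

definition poset_rank :: "'a set \<Rightarrow> ('a \<Rightarrow> 'a \<Rightarrow> bool) \<Rightarrow> 'a \<Rightarrow> nat" where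
  "poset_rank P le = (SOME r. is_rank_function P le r)"

text \<open>Generating functions are polynomials in the indeterminate \<open>q\<close>;
  \<open>monom 1 k\<close> is \<open>q ^ k\<close>.\<close>

definition rank_gf :: "'a set \<Rightarrow> ('a \<Rightarrow> 'a \<Rightarrow> bool) \<Rightarrow> int poly" where
  "rank_gf P le = (\<Sum>x\<in>P. monom 1 (poset_rank P le x))"


section \<open>Bruhat order on permutations and involutions\<close>

text \<open>Permutations of \<open>{1..n}\<close> are functions on \<^typ>\<open>nat\<close> fixing everything outside
  \<open>{1..n}\<close>.\<close>

definition Inv :: "nat \<Rightarrow> (nat \<Rightarrow> nat) \<Rightarrow> (nat \<times> nat) set" where
  "Inv n p = {(i, j) \<in> {1..n} \<times> {1..n}. i < j \<and> p i > p j}"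

definition perm_length :: "nat \<Rightarrow> (nat \<Rightarrow> nat) \<Rightarrow> nat" where
  "perm_length n p = card (Inv n p)"

definition bruhat_step :: "nat \<Rightarrow> (nat \<Rightarrow> nat) \<Rightarrow> (nat \<Rightarrow> nat) \<Rightarrow> bool" where
  "bruhat_step n p p' \<longleftrightarrow> p permutes {1..n} \<and>
     (\<exists>i\<in>{1..n}. \<exists>j\<in>{1..n}. i \<noteq> j \<and> p' = transpose i j \<circ> p \<and>
        perm_length n p' = perm_length n p + 1)"

definition bruhat_le :: "nat \<Rightarrow> (nat \<Rightarrow> nat) \<Rightarrow> (nat \<Rightarrow> nat) \<Rightarrow> bool" where
  "bruhat_le n = (bruhat_step n)\<^sup>*\<^sup>*"

definition involutions :: "nat \<Rightarrow> (nat \<Rightarrow> nat) set" where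
  "involutions n = {p. p permutes {1..n} \<and> p \<circ> p = id}"


section \<open>Labeled Motzkin paths\<close>

datatype step = Up | Down | Level

fun step_dy :: "step \<Rightarrow> int" where
  "step_dy Up = 1"
| "step_dy Down = - 1"
| "step_dy Level = 0"

text \<open>The \<open>y\<close>-coordinate of the path after its first \<open>i\<close> steps.\<close>

definition ycoord :: "step list \<Rightarrow> nat \<Rightarrow> int" where
  "ycoord \<mu> i = sum_list (map step_dy (take i \<mu>))"

definition motzkin_paths :: "nat \<Rightarrow> step list set" where
  "motzkin_paths n = {\<mu>. length \<mu> = n \<and> ycoord \<mu> n = 0 \<and> (\<forall>i\<le>n. ycoord \<mu> i \<ge> 0)}"

text \<open>Steps are numbered from 1, so the \<open>i\<close>th step is \<open>\<mu> ! (i - 1)\<close>.\<close>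

definition step_height :: "step list \<Rightarrow> nat \<Rightarrow> nat" where
  "step_height \<mu> i = nat (max (ycoord \<mu> (i - 1)) (ycoord \<mu> i))"

definition labelings :: "step list \<Rightarrow> (nat \<Rightarrow> nat) set" where
  "labelings \<mu> =
     (\<Pi>\<^sub>E i \<in> {i \<in> {1..length \<mu>}. \<mu> ! (i - 1) = Down}. {1..step_height \<mu> i})"

definition H_step :: "step list \<Rightarrow> (nat \<Rightarrow> nat) \<Rightarrow> nat \<Rightarrow> nat" where
  "H_step \<mu> lab i = (if \<mu> ! (i - 1) = Down then lab i - 1 else step_height \<mu> i)"

definition H_total :: "step list \<Rightarrow> (nat \<Rightarrow> nat) \<Rightarrow> nat" where
  "H_total \<mu> lab = (\<Sum>i = 1..length \<mu>. H_step \<mu> lab i)"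

definition H_gf :: "step list \<Rightarrow> int poly" where
  "H_gf \<mu> = (\<Sum>lab\<in>labelings \<mu>. monom 1 (H_total \<mu> lab))"

end

theory Submission
  imports Defs
begin

text \<open>Conjugation by an adjacent transposition (or multiplication by it, when the two commute)
  raises an involution with an ascent by one in \<open>inv_rank\<close>, and the resulting up and down
  operators are monotone in Bruhat order because one-sided multiplication is. This lifting property
  yields that Bruhat order on involutions is graded by \<open>inv_rank\<close>.

  For the generating function, consider involutions in which the first \<open>h\<close> points are all
  matched with points beyond \<open>h\<close>; these correspond to labeled Motzkin paths that have reached
  height \<open>h\<close>. Point \<open>h + 1\<close> either opens an arc (up step), is fixed (level step), or
  closes the arc of some \<open>j \<le> h\<close> (down step); conjugating by adjacent transpositions moves the fixed
  point or the arc to the far left, each move costing one unit of rank, after which it is removed.\<close>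

section \<open>Bruhat order and adjacent transpositions\<close>

abbreviation adj :: "nat \<Rightarrow> nat \<Rightarrow> nat" where
  "adj k \<equiv> transpose k (Suc k)"

lemma comp_transpose: "inj p \<Longrightarrow> p \<circ> transpose i j = transpose (p i) (p j) \<circ> p"
  by (auto simp: fun_eq_iff transpose_def inj_eq)

lemma transpose_in_Icc:
  "\<lbrakk>i \<in> {1..n}; j \<in> {1..n}; x \<in> {1..n}\<rbrakk> \<Longrightarrow> transpose i j x \<in> {1..n::nat}"
  by (auto simp: transpose_def)

lemma permutes_comp_transpose:
  "\<lbrakk>p permutes {1..n}; i \<in> {1..n}; j \<in> {1..n::nat}\<rbrakk> \<Longrightarrow> p \<circ> transpose i j permutes {1..n}"
  by (meson permutes_compose permutes_swap_id)

section \<open>Length of a permutation under transpositions of positions and under inversion\<close>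

lemma finite_Inv [simp]: "finite (Inv n p)"
  by (rule finite_subset[of _ "{1..n} \<times> {1..n}"]) (auto simp: Inv_def)

text \<open>Old inversions inject into the new ones. An inversion is carried along by the
  transposition if the order of its positions survives; otherwise the pair is kept, and it stays an
  inversion because \<open>p i < p j\<close>. The new inversion \<open>(i, j)\<close> is never hit,
  so the inequality is strict.\<close>

lemma perm_length_transpose_less:
  assumes "inj p" "i \<in> {1..n}" "j \<in> {1..n}" "i < j" "p i < p j"
  shows "perm_length n p < perm_length n (p \<circ> transpose i j)"
proof -
  let ?t = "transpose i j" and ?q = "p \<circ> transpose i j"
  define f where "f = (\<lambda>(a, b). if ?t a < ?t b then (?t a, ?t b) else (a, b))"
  have "inj_on f (Inv n p)"
  proof (rule inj_onI)
    fix x y assume "x \<in> Inv n p" "y \<in> Inv n p" "f x = f y"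
    then show "x = y"
      by (cases x; cases y) (auto simp: f_def Inv_def dest: transpose_eq_imp_eq split: if_splits)
  qed
  moreover have "f ` Inv n p \<subseteq> Inv n ?q - {(i, j)}"
  proof
    fix y assume "y \<in> f ` Inv n p"
    then obtain a b where ab: "a \<in> {1..n}" "b \<in> {1..n}" "a < b" "p b < p a" and y: "y = f (a, b)"
      by (auto simp: Inv_def)
    show "y \<in> Inv n ?q - {(i, j)}"
    proof (cases "?t a < ?t b")
      case True
      then have "y = (?t a, ?t b)" by (simp add: y f_def)
      moreover have "(?t a, ?t b) \<noteq> (i, j)"
        using ab(3) assms(4) by (auto simp: transpose_eq_iff)
      ultimately show ?thesis
        using True ab transpose_in_Icc[OF assms(2,3)] by (simp add: Inv_def)
    next
      case False
      then have "y = (a, b)" by (simp add: y f_def)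
      moreover have "p (?t b) < p (?t a)" "(a, b) \<noteq> (i, j)"
        using False ab assms by (auto simp: transpose_def split: if_splits)
      ultimately show ?thesis
        using ab by (simp add: Inv_def)
    qed
  qed
  ultimately have "card (Inv n p) \<le> card (Inv n ?q - {(i, j)})"
    by (intro card_inj_on_le) auto
  moreover have "(i, j) \<in> Inv n ?q"
    using assms by (auto simp: Inv_def)
  ultimately show ?thesis
    unfolding perm_length_def by (meson card_Diff1_less finite_Inv le_less_trans)
qed

lemma perm_length_transpose_less_iff:
  assumes "inj p" "i \<in> {1..n}" "j \<in> {1..n}" "i < j"
  shows "perm_length n p < perm_length n (p \<circ> transpose i j) \<longleftrightarrow> p i < p j"
proof (cases "p i < p j")
  case True
  then show ?thesis using perm_length_transpose_less assms by blast
next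
  case False
  let ?q = "p \<circ> transpose i j"
  have "p j < p i"
    using False assms by (metis inj_eq linorder_neqE_nat less_irrefl)
  then have "perm_length n ?q < perm_length n (?q \<circ> transpose i j)"
    using assms by (intro perm_length_transpose_less) (auto intro: inj_compose)
  then have "perm_length n ?q < perm_length n p" by (simp add: comp_assoc)
  then show ?thesis using False by simp
qed

text \<open>\<open>adj k\<close> reverses the order of no pair of positions other than
  \<open>(k, Suc k)\<close>, so the old inversions are relabeled bijectively and exactly that pair
  is added.\<close>

lemma perm_length_adj:
  assumes "inj p" "1 \<le> k" "k < n" "p k < p (Suc k)"
  shows "perm_length n (p \<circ> adj k) = Suc (perm_length n p)"
proof -
  let ?f = "map_prod (adj k) (adj k)"
  have "Inv n (p \<circ> adj k) = insert (k, Suc k) (?f ` Inv n p)"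
  proof (intro equalityI subsetI)
    fix x assume "x \<in> Inv n (p \<circ> adj k)"
    then obtain a b where x: "x = (a, b)" "a \<in> {1..n}" "b \<in> {1..n}" "a < b"
      "p (adj k b) < p (adj k a)"
      by (auto simp: Inv_def)
    show "x \<in> insert (k, Suc k) (?f ` Inv n p)"
    proof (cases "x = (k, Suc k)")
      case False
      then have "adj k a < adj k b"
        using x by (auto simp: transpose_def)
      moreover have "adj k a \<in> {1..n}" "adj k b \<in> {1..n}"
        using x assms transpose_in_Icc[of k n "Suc k" a] transpose_in_Icc[of k n "Suc k" b] by auto
      ultimately have "(adj k a, adj k b) \<in> Inv n p"
        using x by (simp add: Inv_def)
      then have "?f (adj k a, adj k b) \<in> ?f ` Inv n p" by (rule imageI)
      then show ?thesis by (simp add: x)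
    qed simp
  next
    fix x assume "x \<in> insert (k, Suc k) (?f ` Inv n p)"
    then show "x \<in> Inv n (p \<circ> adj k)"
    proof
      assume "x = (k, Suc k)"
      then show ?thesis using assms by (auto simp: Inv_def)
    next
      assume "x \<in> ?f ` Inv n p"
      then obtain a b where x: "x = (adj k a, adj k b)" "a \<in> {1..n}" "b \<in> {1..n}" "a < b" "p b < p a"
        by (auto simp: Inv_def)
      moreover have "adj k a < adj k b"
        using x assms by (auto simp: transpose_def)
      moreover have "adj k a \<in> {1..n}" "adj k b \<in> {1..n}"
        using x assms transpose_in_Icc[of k n "Suc k" a] transpose_in_Icc[of k n "Suc k" b] by auto
      ultimately show ?thesis
        by (simp add: Inv_def)
    qed
  qed
  moreover have "(k, Suc k) \<notin> ?f ` Inv n p"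
  proof
    assume "(k, Suc k) \<in> ?f ` Inv n p"
    then obtain a b where "(a, b) \<in> Inv n p" "adj k a = k" "adj k b = Suc k"
      by auto
    then show False
      by (auto simp: Inv_def transpose_eq_iff)
  qed
  moreover have "inj ?f"
    by (intro prod.inj_map) simp_all
  ultimately show ?thesis
    by (simp add: perm_length_def card_image inj_on_subset)
qed

lemma perm_length_inv:
  assumes "p permutes {1..n}"
  shows "perm_length n (inv p) = perm_length n p"
proof -
  have im: "p x \<in> {Suc 0..n} \<longleftrightarrow> x \<in> {Suc 0..n}" "inv p x \<in> {Suc 0..n} \<longleftrightarrow> x \<in> {Suc 0..n}" for x
    using permutes_in_image[OF assms] permutes_in_image[OF permutes_inv[OF assms]] by simp_all
  have "bij_betw (\<lambda>(i, j). (p j, p i)) (Inv n p) (Inv n (inv p))"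
    by (rule bij_betw_byWitness[where f' = "\<lambda>(i, j). (inv p j, inv p i)"])
      (auto simp: Inv_def permutes_inverses[OF assms] im simp del: atLeastAtMost_iff)
  then show ?thesis
    by (simp add: perm_length_def bij_betw_same_card)
qed

text \<open>Left multiplication exchanges values. Rewriting it as an exchange of positions makes the
  length lemmas applicable and shows that a step may be taken on either side.\<close>

lemma bruhat_step_iff:
  "bruhat_step n p p' \<longleftrightarrow> p permutes {1..n} \<and>
     (\<exists>i\<in>{1..n}. \<exists>j\<in>{1..n}. i < j \<and> p' = p \<circ> transpose i j \<and>
        perm_length n p' = perm_length n p + 1)" (is "_ \<longleftrightarrow> ?R")
proof
  assume *: "bruhat_step n p p'"
  then obtain a b where p: "p permutes {1..n}" and ab: "a \<in> {1..n}" "b \<in> {1..n}" "a \<noteq> b"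
    "p' = transpose a b \<circ> p" and len: "perm_length n p' = perm_length n p + 1"
    by (auto simp: bruhat_step_def)
  have eq: "p' = p \<circ> transpose (inv p a) (inv p b)"
    using comp_transpose[OF permutes_inj[OF p]] p ab by (simp add: permutes_inverses)
  have ip: "inv p permutes {1..n}" by (rule permutes_inv[OF p])
  have mem: "inv p a \<in> {1..n}" "inv p b \<in> {1..n}"
    using ab permutes_in_image[OF ip] by auto
  have "inv p a \<noteq> inv p b"
    using ab permutes_inj[OF ip] by (simp add: inj_eq)
  then consider "inv p a < inv p b" | "inv p b < inv p a" by linarith
  then show ?R
    using p len mem eq transpose_commute[of "inv p a" "inv p b"] by cases metis+
next
  assume ?R
  then obtain i j where p: "p permutes {1..n}" and ij: "i \<in> {1..n}" "j \<in> {1..n}" "i < j"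
    "p' = p \<circ> transpose i j" and len: "perm_length n p' = perm_length n p + 1"
    by auto
  have "p' = transpose (p i) (p j) \<circ> p" "p i \<noteq> p j" "p i \<in> {1..n}" "p j \<in> {1..n}"
    using comp_transpose[OF permutes_inj[OF p]] ij permutes_in_image[OF p] permutes_inj[OF p]
    by (auto simp: inj_eq)
  with p len show "bruhat_step n p p'"
    unfolding bruhat_step_def by blast
qed

lemma bruhat_step_permutes:
  assumes "bruhat_step n p p'"
  shows "p permutes {1..n}" "p' permutes {1..n}"
  using assms unfolding bruhat_step_iff by (auto intro: permutes_comp_transpose[simplified])

text \<open>Inversion preserves length and turns left multiplication by a transposition into right
  multiplication, which is again a Bruhat step.\<close>

lemma bruhat_step_inv:
  assumes "bruhat_step n p p'"
  shows "bruhat_step n (inv p) (inv p')"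
proof -
  from assms obtain a b where p: "p permutes {1..n}" and ab: "a \<in> {1..n}" "b \<in> {1..n}" "a \<noteq> b"
    "p' = transpose a b \<circ> p" and len: "perm_length n p' = perm_length n p + 1"
    by (auto simp: bruhat_step_def)
  have "inv p' = inv p \<circ> transpose a b"
    using ab p by (simp add: o_inv_distrib permutes_bij)
  moreover have "p' permutes {1..n}"
    using assms by (rule bruhat_step_permutes)
  moreover consider "a < b" | "b < a" using ab by linarith
  ultimately show ?thesis
    unfolding bruhat_step_iff
    using p ab len permutes_inv[OF p] transpose_commute[of a b]
    by cases (metis perm_length_inv)+
qed

lemma bruhat_le_refl [simp]: "bruhat_le n p p"
  by (simp add: bruhat_le_def)

lemma bruhat_le_trans [trans]: "\<lbrakk>bruhat_le n p q; bruhat_le n q r\<rbrakk> \<Longrightarrow> bruhat_le n p r"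
  unfolding bruhat_le_def by (rule rtranclp_trans)

lemma bruhat_step_imp_le: "bruhat_step n p q \<Longrightarrow> bruhat_le n p q"
  unfolding bruhat_le_def by (rule r_into_rtranclp)

lemma bruhat_le_length: "bruhat_le n p q \<Longrightarrow> p = q \<or> perm_length n p < perm_length n q"
  unfolding bruhat_le_def
  by (induction rule: rtranclp_induct) (auto simp: bruhat_step_def)

lemma bruhat_le_antisym: "\<lbrakk>bruhat_le n p q; bruhat_le n q p\<rbrakk> \<Longrightarrow> p = q"
  using bruhat_le_length by (metis less_asym)

lemma bruhat_le_map:
  assumes "\<And>p q. bruhat_step n p q \<Longrightarrow> bruhat_le n (f p) (f q)" and "bruhat_le n p q"
  shows "bruhat_le n (f p) (f q)"
  using assms(2)[unfolded bruhat_le_def]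
  by (induction rule: rtranclp_induct) (auto intro: assms(1) bruhat_le_trans)

lemma bruhat_le_inv: "bruhat_le n p q \<Longrightarrow> bruhat_le n (inv p) (inv q)"
  by (rule bruhat_le_map[where f = inv]) (auto intro: bruhat_step_imp_le bruhat_step_inv)

text \<open>For permutations and \<open>k\<close> in range, this is the Demazure product with
  \<open>adj k\<close>: the larger of \<open>p\<close> and \<open>p \<circ> adj k\<close> in Bruhat
  order. \<open>right_down\<close> is the smaller of the two.\<close>

definition right_up :: "nat \<Rightarrow> (nat \<Rightarrow> nat) \<Rightarrow> nat \<Rightarrow> nat" where
  "right_up k p = (if p k < p (Suc k) then p \<circ> adj k else p)"

definition right_down :: "nat \<Rightarrow> (nat \<Rightarrow> nat) \<Rightarrow> nat \<Rightarrow> nat" where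
  "right_down k p = (if p k < p (Suc k) then p else p \<circ> adj k)"

context
  fixes k n :: nat
  assumes k: "1 \<le> k" "k < n"
begin

lemma bruhat_step_adj_up:
  assumes "p permutes {1..n}" "p k < p (Suc k)"
  shows "bruhat_step n p (p \<circ> adj k)"
  unfolding bruhat_step_iff
  using assms k perm_length_adj[OF permutes_inj[OF assms(1)] k assms(2)]
  by (intro conjI bexI[of _ k] bexI[of _ "Suc k"]) auto

lemma perm_length_adj_down:
  assumes "p permutes {1..n}" "\<not> p k < p (Suc k)"
  shows "perm_length n p = Suc (perm_length n (p \<circ> adj k))"
proof -
  have "p (Suc k) < p k"
    using assms permutes_inj[OF assms(1)] by (metis inj_eq linorder_neqE_nat n_not_Suc_n)
  then have "perm_length n (p \<circ> adj k \<circ> adj k) = Suc (perm_length n (p \<circ> adj k))"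
    using k permutes_inj[OF assms(1)] by (intro perm_length_adj) (auto intro: inj_compose)
  then show ?thesis by (simp add: comp_assoc)
qed

lemma bruhat_step_adj_down:
  assumes "p permutes {1..n}" "\<not> p k < p (Suc k)"
  shows "bruhat_step n (p \<circ> adj k) p"
proof -
  have "p (Suc k) < p k"
    using assms permutes_inj[OF assms(1)] by (metis inj_eq linorder_neqE_nat n_not_Suc_n)
  then have "bruhat_step n (p \<circ> adj k) (p \<circ> adj k \<circ> adj k)"
    using k assms by (intro bruhat_step_adj_up permutes_comp_transpose) auto
  then show ?thesis by (simp add: comp_assoc)
qed

text \<open>A transposition that changes the length of \<open>p\<close> and of \<open>p \<circ> adj k\<close> in opposite
  directions must exchange the entries in positions \<open>k\<close> and \<open>Suc k\<close>.\<close>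

lemma bruhat_step_adj_cases:
  assumes step: "bruhat_step n p q"
  shows "(p k < p (Suc k) \<longleftrightarrow> q k < q (Suc k)) \<and> bruhat_step n (p \<circ> adj k) (q \<circ> adj k)
    \<or> \<not> p k < p (Suc k) \<and> q k < q (Suc k)
    \<or> p k < p (Suc k) \<and> \<not> q k < q (Suc k) \<and> q = p \<circ> adj k"
proof -
  from step obtain a b where p: "p permutes {1..n}" and ab: "a \<in> {1..n}" "b \<in> {1..n}" "a \<noteq> b"
    "q = transpose a b \<circ> p" and len: "perm_length n q = perm_length n p + 1"
    by (auto simp: bruhat_step_def)
  have q: "q permutes {1..n}" using step by (rule bruhat_step_permutes)
  have pk: "p \<circ> adj k permutes {1..n}"
    using p k by (intro permutes_comp_transpose) auto
  have eqk: "q \<circ> adj k = transpose a b \<circ> (p \<circ> adj k)" using ab by (simp add: comp_assoc)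
  \<comment> \<open>Both lengths change by one in the same direction, so their difference remains
    one.\<close>
  have same: "bruhat_step n (p \<circ> adj k) (q \<circ> adj k)" if "p k < p (Suc k) \<longleftrightarrow> q k < q (Suc k)"
  proof -
    have "perm_length n (q \<circ> adj k) = perm_length n (p \<circ> adj k) + 1"
      using that len perm_length_adj_down[OF p] perm_length_adj_down[OF q]
        perm_length_adj[OF permutes_inj[OF p] k] perm_length_adj[OF permutes_inj[OF q] k]
      by (cases "p k < p (Suc k)") simp_all
    then show ?thesis
      unfolding bruhat_step_def using pk ab eqk by blast
  qed
  have "q = p \<circ> adj k" if pq: "p k < p (Suc k)" "\<not> q k < q (Suc k)"
  proof -
    from step obtain i j where ij: "i \<in> {1..n}" "j \<in> {1..n}" "i < j" "q = p \<circ> transpose i j"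
      by (auto simp: bruhat_step_iff)
    have pij: "p i < p j"
      using perm_length_transpose_less_iff[OF permutes_inj[OF p] ij(1-3)] len ij by simp
    show ?thesis
    proof (cases "i = k \<and> j = Suc k")
      case False
      then have lt: "adj k i < adj k j"
        using ij by (auto simp: transpose_def)
      have "adj k \<circ> transpose i j = transpose (adj k i) (adj k j) \<circ> adj k"
        by (rule comp_transpose) simp
      then have "transpose i j \<circ> adj k = adj k \<circ> transpose (adj k i) (adj k j)"
        by (metis comp_assoc comp_id id_comp transpose_comp_involutory)
      then have eq: "q \<circ> adj k = (p \<circ> adj k) \<circ> transpose (adj k i) (adj k j)"
        by (simp add: ij comp_assoc)
      \<comment> \<open>Contradiction: \<open>p \<circ> adj k\<close> is as long as
        \<open>q\<close>, because both exceed \<open>p\<close> by one, whereas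
        \<open>q \<circ> adj k\<close> is shorter than \<open>q\<close>.\<close>
      have "perm_length n (p \<circ> adj k) < perm_length n (q \<circ> adj k)"
        unfolding eq
        using pij lt ij k transpose_in_Icc[of k n "Suc k"] permutes_inj[OF pk]
        by (intro perm_length_transpose_less) auto
      moreover have "perm_length n (q \<circ> adj k) < perm_length n q"
        using perm_length_adj_down[OF q pq(2)] by simp
      ultimately show ?thesis
        using perm_length_adj[OF permutes_inj[OF p] k pq(1)] len by simp
    qed (use ij in simp)
  qed
  then show ?thesis using same by blast
qed

text \<open>It suffices to treat a single step. If \<open>p\<close> and \<open>q\<close> agree on
  having an ascent at \<open>k\<close>, the step is kept or moved along; if only \<open>q\<close>
  has one, then \<open>p \<le> q \<le> q \<circ> adj k\<close>; if only \<open>p\<close> has one,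
  then \<open>p \<circ> adj k = q\<close> and both images coincide.\<close>

lemma bruhat_le_right_up:
  assumes "bruhat_le n p q" shows "bruhat_le n (right_up k p) (right_up k q)"
proof (rule bruhat_le_map[OF _ assms])
  fix p q assume step: "bruhat_step n p q"
  note perm = bruhat_step_permutes[OF step]
  show "bruhat_le n (right_up k p) (right_up k q)"
    using bruhat_step_adj_cases[OF step] step bruhat_step_adj_up[OF perm(2)]
    by (auto simp: right_up_def intro: bruhat_step_imp_le bruhat_le_trans)
qed

lemma bruhat_le_right_down:
  assumes "bruhat_le n p q" shows "bruhat_le n (right_down k p) (right_down k q)"
proof (rule bruhat_le_map[OF _ assms])
  fix p q assume step: "bruhat_step n p q"
  note perm = bruhat_step_permutes[OF step]
  show "bruhat_le n (right_down k p) (right_down k q)"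
    using bruhat_step_adj_cases[OF step] step bruhat_step_adj_down[OF perm(1)]
    by (auto simp: right_down_def comp_assoc intro: bruhat_step_imp_le bruhat_le_trans)
qed

end

section \<open>Bruhat order on involutions\<close>

text \<open>This is Demazure conjugation by \<open>adj k\<close>. When \<open>p\<close> fixes both
  \<open>k\<close> and \<open>Suc k\<close>, conjugation would return \<open>p\<close>, so a single
  multiplication replaces it; \<open>inv_down\<close> makes the same exception when \<open>p\<close>
  exchanges the two points.\<close>

definition inv_up :: "nat \<Rightarrow> (nat \<Rightarrow> nat) \<Rightarrow> nat \<Rightarrow> nat" where
  "inv_up k p =
    (if p k < p (Suc k)
     then if p k = k \<and> p (Suc k) = Suc k then p \<circ> adj k else adj k \<circ> p \<circ> adj k
     else p)"

definition inv_down :: "nat \<Rightarrow> (nat \<Rightarrow> nat) \<Rightarrow> nat \<Rightarrow> nat" where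
  "inv_down k p =
    (if p k < p (Suc k) then p
     else if p k = Suc k then p \<circ> adj k else adj k \<circ> p \<circ> adj k)"

text \<open>\<open>inv_rank\<close> is the statistic \<open>(\<ell> + c) / 2\<close>. The
  truncation in \<open>div\<close> is harmless since only increments of \<open>\<ell> + c\<close> by two are used.\<close>

definition inv_rank :: "nat \<Rightarrow> (nat \<Rightarrow> nat) \<Rightarrow> nat" where
  "inv_rank n p = (perm_length n p + card {i \<in> {1..n}. i < p i}) div 2"

lemma involutions_iff:
  "p \<in> involutions n \<longleftrightarrow> p permutes {1..n} \<and> (\<forall>i. p (p i) = i)"
  by (auto simp: involutions_def fun_eq_iff)

lemma involutionsD:
  assumes "p \<in> involutions n"
  shows "p permutes {1..n}" "p (p i) = i" "inv p = p" "p i = p j \<longleftrightarrow> i = j"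
    "p i \<in> {1..n} \<longleftrightarrow> i \<in> {1..n}"
proof -
  show *: "p permutes {1..n}" "p (p i) = i"
    using assms by (auto simp: involutions_iff)
  show "inv p = p"
    using assms by (intro inv_unique_comp) (auto simp: involutions_def)
  show "p i = p j \<longleftrightarrow> i = j" "p i \<in> {1..n} \<longleftrightarrow> i \<in> {1..n}"
    using permutes_inj[OF *(1)] permutes_in_image[OF *(1)] by (auto simp: inj_eq)
qed

lemma finite_involutions [simp]: "finite (involutions n)"
  by (rule finite_subset[OF _ finite_permutations[of "{1..n}"]]) (auto simp: involutions_def)

lemma perm_length_id [simp]: "perm_length n id = 0"
proof -
  have "Inv n id = {}" by (auto simp: Inv_def)
  then show ?thesis by (simp add: perm_length_def)
qed

lemma inv_rank_id [simp]: "inv_rank n id = 0"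
  by (simp add: inv_rank_def)

text \<open>For an involution, an ascent at \<open>k\<close> of both \<open>p\<close> and its inverse fails to be an
  ascent of \<open>inv (p \<circ> adj k)\<close> only if \<open>p\<close> fixes \<open>k\<close> and \<open>Suc k\<close>.\<close>

lemma inv_up_eq:
  assumes "p \<in> involutions n"
  shows "inv_up k p = inv (right_up k (inv (right_up k p)))"
proof -
  note p = involutionsD[OF assms]
  have bij: "bij p" using p(1) by (rule permutes_bij)
  have inv_eq: "inv (p \<circ> adj k) = adj k \<circ> p" "inv (adj k \<circ> p) = p \<circ> adj k"
      "inv (adj k \<circ> (p \<circ> adj k)) = adj k \<circ> (p \<circ> adj k)"
    by (simp_all add: o_inv_distrib bij bij_comp p(3) comp_assoc)
  have "adj k (p k) < adj k (p (Suc k)) \<longleftrightarrow> \<not> (p k = k \<and> p (Suc k) = Suc k)"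
    if "p k < p (Suc k)"
    using that p(4)[of k] p(4)[of "Suc k"] by (auto simp: transpose_def split: if_splits)
  then show ?thesis
    by (auto simp: inv_up_def right_up_def inv_eq p(3) comp_assoc simp del: transpose_apply_first)
qed

text \<open>Dually, a descent of the involution \<open>p\<close> at \<open>k\<close> is lost by
  \<open>inv (p \<circ> adj k)\<close>, which is \<open>adj k \<circ> p\<close>, exactly when
  \<open>p k = Suc k\<close>; then the second \<open>right_down\<close> does nothing.\<close>

lemma inv_down_eq:
  assumes "p \<in> involutions n"
  shows "inv_down k p = inv (right_down k (inv (right_down k p)))"
proof -
  note p = involutionsD[OF assms]
  have bij: "bij p" using p(1) by (rule permutes_bij)
  have inv_eq: "inv (p \<circ> adj k) = adj k \<circ> p" "inv (adj k \<circ> p) = p \<circ> adj k"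
      "inv (adj k \<circ> (p \<circ> adj k)) = adj k \<circ> (p \<circ> adj k)"
    by (simp_all add: o_inv_distrib bij bij_comp p(3) comp_assoc)
  have "adj k (p k) < adj k (p (Suc k)) \<longleftrightarrow> p k = Suc k"
    if "\<not> p k < p (Suc k)"
    using that p(2)[of k] p(2)[of "Suc k"] p(4)[of k "Suc k"]
    by (auto simp: transpose_def split: if_splits)
  then show ?thesis
    by (auto simp: inv_down_def right_down_def inv_eq p(3) comp_assoc)
qed

text \<open>The only pair whose order \<open>adj k\<close> reverses is \<open>k\<close>,
  \<open>Suc k\<close>. Since \<open>p\<close> does not match these two points, \<open>adj k\<close>
  carries exceedances to exceedances.\<close>

lemma card_exceedances_conj:
  assumes "p \<in> involutions n" "1 \<le> k" "k < n" "p k \<noteq> Suc k"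
  shows "card {i \<in> {1..n}. i < (adj k \<circ> p \<circ> adj k) i} = card {i \<in> {1..n}. i < p i}"
proof -
  note p = involutionsD[OF assms(1)]
  have pk: "p k \<noteq> Suc k" "p (Suc k) \<noteq> k" using assms(4) p(2) by metis+
  have less_iff: "adj k i < adj k (p i) \<longleftrightarrow> i < p i" for i
    using pk by (auto simp: transpose_def)
  have mem: "adj k i \<in> {1..n} \<longleftrightarrow> i \<in> {1..n}" for i
    using assms(2,3) by (auto simp: transpose_def)
  have "{i \<in> {1..n}. i < (adj k \<circ> p \<circ> adj k) i} = adj k ` {i \<in> {1..n}. i < p i}"
  proof (rule set_eqI)
    fix i
    show "i \<in> {i \<in> {1..n}. i < (adj k \<circ> p \<circ> adj k) i} \<longleftrightarrow> i \<in> adj k ` {i \<in> {1..n}. i < p i}"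
      unfolding in_transpose_image_iff mem_Collect_eq mem less_iff[of "adj k i", symmetric]
      by simp
  qed
  then show ?thesis by (simp add: card_image)
qed

context
  fixes k n :: nat
  assumes k: "1 \<le> k" "k < n"
begin

lemma bruhat_le_inv_up:
  assumes "p \<in> involutions n" "q \<in> involutions n" "bruhat_le n p q"
  shows "bruhat_le n (inv_up k p) (inv_up k q)"
  unfolding inv_up_eq[OF assms(1)] inv_up_eq[OF assms(2)]
  by (intro bruhat_le_inv bruhat_le_right_up k assms(3))

lemma bruhat_le_inv_down:
  assumes "p \<in> involutions n" "q \<in> involutions n" "bruhat_le n p q"
  shows "bruhat_le n (inv_down k p) (inv_down k q)"
  unfolding inv_down_eq[OF assms(1)] inv_down_eq[OF assms(2)]
  by (intro bruhat_le_inv bruhat_le_right_down k assms(3))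

lemma conj_adj_involutions:
  "p \<in> involutions n \<Longrightarrow> adj k \<circ> p \<circ> adj k \<in> involutions n"
  unfolding involutions_iff
  by (intro conjI permutes_compose permutes_swap_id) (use k in auto)

text \<open>In both cases \<open>p\<close> maps the pair \<open>k\<close>, \<open>Suc k\<close> to
  itself and hence commutes with \<open>adj k\<close>.\<close>

lemma comp_adj_involutions:
  assumes p: "p \<in> involutions n" and pk: "p k = k \<and> p (Suc k) = Suc k \<or> p k = Suc k"
  shows "p \<circ> adj k \<in> involutions n"
proof -
  have pi: "p (p i) = i" for i using involutionsD(2)[OF p] .
  have swap: "p \<circ> adj k = adj k \<circ> p"
  proof -
    have "transpose (p k) (p (Suc k)) = adj k"
    proof (cases "p k = Suc k")
      case True
      then have "p (Suc k) = k" using pi by metis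
      then show ?thesis using True by (simp add: transpose_commute)
    qed (use pk in simp)
    then show ?thesis
      using comp_transpose[OF permutes_inj[OF involutionsD(1)[OF p]], of k "Suc k"] by simp
  qed
  have "(p \<circ> adj k) ((p \<circ> adj k) i) = i" for i
    using fun_cong[OF swap, of "p (adj k i)"] by (simp add: pi)
  moreover have "p \<circ> adj k permutes {1..n}"
    using k by (intro permutes_comp_transpose involutionsD(1)[OF p]) auto
  ultimately show ?thesis unfolding involutions_iff by blast
qed

lemma inv_up_involutions: "p \<in> involutions n \<Longrightarrow> inv_up k p \<in> involutions n"
  by (auto simp: inv_up_def conj_adj_involutions comp_adj_involutions)

lemma inv_down_involutions: "p \<in> involutions n \<Longrightarrow> inv_down k p \<in> involutions n"
  by (auto simp: inv_down_def conj_adj_involutions comp_adj_involutions)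

lemma inv_down_ascent:
  assumes "p \<in> involutions n" "p (Suc k) < p k"
  shows "inv_down k p k < inv_down k p (Suc k)"
  using assms(2) involutionsD(2)[OF assms(1), of k] involutionsD(2)[OF assms(1), of "Suc k"]
  by (auto simp: inv_down_def transpose_def split: if_splits)

lemma inv_up_inv_down:
  assumes "p \<in> involutions n" "p (Suc k) < p k"
  shows "inv_up k (inv_down k p) = p"
proof (cases "p k = Suc k")
  case True
  moreover have "p (Suc k) = k"
    using True involutionsD(2)[OF assms(1)] by metis
  ultimately show ?thesis
    using assms(2) by (simp add: inv_down_def inv_up_def comp_assoc)
next
  case False
  then have d: "inv_down k p = adj k \<circ> p \<circ> adj k" using assms by (simp add: inv_down_def)
  have "p (Suc k) \<noteq> k" using False involutionsD(2)[OF assms(1)] by metis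
  then have "\<not> (inv_down k p k = k \<and> inv_down k p (Suc k) = Suc k)"
    using False assms(2) by (auto simp: d transpose_eq_iff)
  then have "inv_up k (inv_down k p) = adj k \<circ> inv_down k p \<circ> adj k"
    using inv_down_ascent[OF assms] by (simp only: inv_up_def if_True if_False)
  also have "\<dots> = p" by (simp add: d fun_eq_iff)
  finally show ?thesis .
qed

text \<open>The sum of length and number of exceedances grows by two either way: multiplication adds
  one inversion and the exceedance \<open>k\<close>, while conjugation adds two to the length and
  preserves the number of exceedances.\<close>

lemma inv_rank_inv_up:
  assumes p: "p \<in> involutions n" and asc: "p k < p (Suc k)"
  shows "inv_rank n (inv_up k p) = Suc (inv_rank n p)"
proof (cases "p k = k \<and> p (Suc k) = Suc k")
  case True
  then have up: "inv_up k p = p \<circ> adj k" using asc by (simp add: inv_up_def)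
  have "{i \<in> {1..n}. i < (p \<circ> adj k) i} = insert k {i \<in> {1..n}. i < p i}"
    using True k by (auto simp: transpose_def)
  moreover have "k \<notin> {i \<in> {1..n}. i < p i}" using True by simp
  ultimately have "card {i \<in> {1..n}. i < (p \<circ> adj k) i} = Suc (card {i \<in> {1..n}. i < p i})"
    by simp
  then show ?thesis
    using perm_length_adj[OF permutes_inj[OF involutionsD(1)[OF p]] k asc]
    by (simp add: inv_rank_def up)
next
  case False
  then have up: "inv_up k p = adj k \<circ> p \<circ> adj k"
    by (simp only: inv_up_def asc if_True if_False)
  note perm = involutionsD(1)[OF p] involutionsD(1)[OF conj_adj_involutions[OF p]]
  let ?q = "p \<circ> adj k"
  have q: "?q permutes {1..n}"
    using k perm(1) by (intro permutes_comp_transpose) auto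
  have inv_eq: "inv ?q = adj k \<circ> p"
    by (simp add: o_inv_distrib permutes_bij[OF perm(1)] involutionsD(3)[OF p])
  have "(adj k \<circ> p) k < (adj k \<circ> p) (Suc k)"
    using asc False by (auto simp: transpose_def)
  then have "perm_length n (adj k \<circ> p \<circ> adj k) = Suc (perm_length n (inv ?q))"
    unfolding inv_eq
    using perm_length_adj[OF _ k] permutes_inj[OF permutes_inv[OF q]] inv_eq by simp
  also have "\<dots> = Suc (Suc (perm_length n p))"
    using perm_length_adj[OF permutes_inj[OF perm(1)] k asc] perm_length_inv[OF q] by simp
  finally have len: "perm_length n (adj k \<circ> p \<circ> adj k) = Suc (Suc (perm_length n p))" .
  have "p k \<noteq> Suc k"
    using asc involutionsD(2)[OF p, of k] by (metis less_not_sym lessI)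
  then show ?thesis
    using len card_exceedances_conj[OF p k] by (simp add: inv_rank_def up)
qed

lemma inv_rank_inv_down:
  assumes "p \<in> involutions n" "p (Suc k) < p k"
  shows "inv_rank n p = Suc (inv_rank n (inv_down k p))"
  using inv_rank_inv_up[OF inv_down_involutions[OF assms(1)] inv_down_ascent[OF assms]]
  by (simp add: inv_up_inv_down[OF assms])

text \<open>\<open>inv_down\<close> is two applications of \<open>right_down\<close> with inversions
  in between, and \<open>right_down\<close> never moves up.\<close>

lemma bruhat_le_inv_down_self:
  assumes p: "p \<in> involutions n"
  shows "bruhat_le n (inv_down k p) p"
proof -
  have 1: "bruhat_le n (right_down k q) q" if "q permutes {1..n}" for q
    using bruhat_step_adj_down[OF k that] by (auto simp: right_down_def intro: bruhat_step_imp_le)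
  have 2: "right_down k p permutes {1..n}"
    using k involutionsD(1)[OF p] by (auto simp: right_down_def intro!: permutes_comp_transpose[simplified])
  have "bruhat_le n (inv_down k p) (right_down k p)"
    using bruhat_le_inv[OF 1[OF permutes_inv[OF 2]]] permutes_inv_inv[OF 2]
    by (simp add: inv_down_eq[OF p])
  then show ?thesis
    using 1[OF involutionsD(1)[OF p]] by (rule bruhat_le_trans)
qed

end

section \<open>Gradedness of Bruhat order on involutions\<close>

lemma permutes_strict_mono_eq_id:
  assumes p: "p permutes {1..n}" and asc: "\<And>k. \<lbrakk>1 \<le> k; k < n\<rbrakk> \<Longrightarrow> p k < p (Suc k)"
  shows "p = id"
proof -
  have ge: "i \<le> p i" if "1 \<le> i" "i \<le> n" for i
    using that
  proof (induction i rule: dec_induct)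
    case base
    then show ?case using permutes_in_image[OF p, of 1] by auto
  next
    case (step i)
    then show ?case using asc[of i] by simp
  qed
  \<comment> \<open>Downward from \<open>n\<close>: if \<open>p i\<close> were larger than
    \<open>i\<close>, it would already be a fixed point, contradicting injectivity.\<close>
  have "p i = i" if "1 \<le> i" "i \<le> n" for i
    using that
  proof (induction "n - i" arbitrary: i rule: less_induct)
    case less
    show ?case
    proof (rule ccontr)
      assume "p i \<noteq> i"
      then have "i < p i" "p i \<le> n"
        using ge[of i] less.prems permutes_in_image[OF p, of i] by auto
      then have "p (p i) = p i"
        using less.hyps[of "p i"] less.prems by auto
      then show False
        using \<open>p i \<noteq> i\<close> permutes_inj[OF p] by (simp add: inj_eq)
    qed
  qed
  then show ?thesis
    using p by (auto simp: fun_eq_iff permutes_def)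
qed

lemma exists_descent:
  assumes "p \<in> involutions n" "p \<noteq> id"
  obtains k where "1 \<le> k" "k < n" "p (Suc k) < p k"
proof -
  obtain k where k: "1 \<le> k" "k < n" "\<not> p k < p (Suc k)"
    using permutes_strict_mono_eq_id[OF involutionsD(1)[OF assms(1)]] assms(2) by blast
  moreover have "p k \<noteq> p (Suc k)"
    using involutionsD(4)[OF assms(1)] by simp
  ultimately show thesis by (intro that[of k]) linarith+
qed

text \<open>With \<open>w' = inv_down k w\<close> for a descent \<open>k\<close> of \<open>w\<close>, either \<open>u \<le> w'\<close> by the lifting
  property, or the element below \<open>w'\<close> obtained by induction can be lifted back along \<open>k\<close>.\<close>

lemma exists_between_of_corank_one:
  assumes "u \<in> involutions n" "w \<in> involutions n" "bruhat_le n u w" "u \<noteq> w"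
  shows "\<exists>v\<in>involutions n. bruhat_le n u v \<and> bruhat_le n v w \<and> inv_rank n w = Suc (inv_rank n v)"
  using assms
proof (induction "inv_rank n w" arbitrary: u w rule: less_induct)
  case less
  note uw = less.prems
  have "w \<noteq> id"
  proof
    assume "w = id"
    then have "perm_length n w = 0" by simp
    then show False using bruhat_le_length[OF uw(3)] uw(4) by simp
  qed
  then obtain k where k: "1 \<le> k" "k < n" and desc: "w (Suc k) < w k"
    using exists_descent[OF uw(2)] by blast
  let ?w = "inv_down k w"
  have w: "?w \<in> involutions n" "bruhat_le n ?w w" "inv_up k ?w = w"
    "inv_rank n w = Suc (inv_rank n ?w)"
    using inv_down_involutions bruhat_le_inv_down_self inv_up_inv_down inv_rank_inv_down
      k uw(2) desc by blast+
  have down: "bruhat_le n (inv_down k u) ?w"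
    using k uw by (intro bruhat_le_inv_down)
  show ?case
  proof (cases "u k < u (Suc k)")
    case True
    then have "bruhat_le n u ?w" using down by (simp add: inv_down_def)
    then show ?thesis using w by blast
  next
    case False
    then have desc_u: "u (Suc k) < u k"
      using involutionsD(4)[OF uw(1), of k "Suc k"] by linarith
    let ?u = "inv_down k u"
    have u: "?u \<in> involutions n" "inv_up k ?u = u"
      using inv_down_involutions inv_up_inv_down k uw(1) desc_u by blast+
    \<comment> \<open>Otherwise applying \<open>inv_up k\<close> would give
      \<open>u = w\<close>.\<close>
    have "?u \<noteq> ?w" using u w uw(4) by metis
    then obtain v where v: "v \<in> involutions n" "bruhat_le n ?u v" "bruhat_le n v ?w"
      "inv_rank n ?w = Suc (inv_rank n v)"
      using less.hyps[of ?w ?u] w u down by auto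
    \<comment> \<open>Applying the monotone \<open>inv_up k\<close> to the chain
      \<open>?u \<le> v \<le> ?w\<close> restores \<open>u\<close> and \<open>w\<close> at its ends.
      If \<open>v\<close> has an ascent at \<open>k\<close>, the lifted \<open>v\<close> has the
      required rank; if not, it is \<open>v\<close> itself and \<open>u \<le> ?w\<close>
      follows.\<close>
    have lift: "bruhat_le n u (inv_up k v)" "bruhat_le n (inv_up k v) w"
      using bruhat_le_inv_up[OF k u(1) v(1,2)] bruhat_le_inv_up[OF k v(1) w(1) v(3)]
      by (simp_all add: u w)
    show ?thesis
    proof (cases "v k < v (Suc k)")
      case True
      then have "inv_rank n w = Suc (inv_rank n (inv_up k v))"
        using inv_rank_inv_up[OF k v(1)] v(4) w(4) by simp
      then show ?thesis
        using lift inv_up_involutions[OF k v(1)] by blast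
    next
      case False
      then have "bruhat_le n u v" using lift by (simp add: inv_up_def)
      then have "bruhat_le n u ?w" using v(3) by (rule bruhat_le_trans)
      then show ?thesis using w by blast
    qed
  qed
qed

lemma is_rank_function_inv_rank:
  "is_rank_function (involutions n) (bruhat_le n) (inv_rank n)"
  unfolding is_rank_function_def
proof (intro conjI allI impI)
  fix p assume min: "poset_minimal (involutions n) (bruhat_le n) p"
  then have p: "p \<in> involutions n" by (simp add: poset_minimal_def)
  have "p = id"
  proof (rule ccontr)
    assume "p \<noteq> id"
    then obtain k where k: "1 \<le> k" "k < n" "p (Suc k) < p k"
      using exists_descent[OF p] by blast
    then have "inv_down k p = p"
      using min p inv_down_involutions bruhat_le_inv_down_self by (simp add: poset_minimal_def)
    then show False using inv_rank_inv_down[OF k(1,2) p k(3)] by simp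
  qed
  then show "inv_rank n p = 0" by simp
next
  fix p q assume cov: "poset_covers (involutions n) (bruhat_le n) p q"
  then obtain v where "v \<in> involutions n" "bruhat_le n p v" "bruhat_le n v q"
    "inv_rank n q = Suc (inv_rank n v)"
    using exists_between_of_corank_one unfolding poset_covers_def by blast
  \<comment> \<open>A cover leaves only \<open>v = p\<close> or \<open>v = q\<close>, and the ranks
    exclude the latter.\<close>
  moreover from this have "v = p"
    using cov by (auto simp: poset_covers_def)
  ultimately show "inv_rank n q = inv_rank n p + 1" by simp
qed

text \<open>\<open>poset_rank\<close> is a choice; \<open>inv_rank\<close> witnesses that a rank
  function exists, and uniqueness forces the chosen one to agree with it on the carrier.\<close>

lemma poset_rank_involutions:
  assumes "p \<in> involutions n"
  shows "poset_rank (involutions n) (bruhat_le n) p = inv_rank n p"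
proof (rule rank_function_unique[where r = "poset_rank (involutions n) (bruhat_le n)" and s = "inv_rank n" and
      P = "involutions n" and le = "bruhat_le n"])
  show "is_rank_function (involutions n) (bruhat_le n) (poset_rank (involutions n) (bruhat_le n))"
    unfolding poset_rank_def
    by (rule someI[of _ "inv_rank n"]) (rule is_rank_function_inv_rank)
qed (use assms is_rank_function_inv_rank in \<open>auto intro: bruhat_le_antisym bruhat_le_trans\<close>)

section \<open>Weights of Motzkin paths\<close>

abbreviation qpow :: "nat \<Rightarrow> int poly" where
  "qpow k \<equiv> monom 1 k"

text \<open>Weighted count of the ways to complete a path from height \<open>h\<close> to the axis
  in \<open>n\<close> steps. At \<open>h = 0\<close> the empty sum kills the last term, so the
  truncation in \<open>h - 1\<close> is harmless.\<close>

fun motzkin_gf :: "nat \<Rightarrow> nat \<Rightarrow> int poly" where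
  "motzkin_gf 0 h = (if h = 0 then 1 else 0)"
| "motzkin_gf (Suc n) h =
     qpow (Suc h) * motzkin_gf n (Suc h) + qpow h * motzkin_gf n h
       + (\<Sum>j<h. qpow j) * motzkin_gf n (h - 1)"

definition paths_from :: "nat \<Rightarrow> nat \<Rightarrow> step list set" where
  "paths_from n h =
     {\<mu>. length \<mu> = n \<and> int h + ycoord \<mu> n = 0 \<and> (\<forall>i\<le>n. 0 \<le> int h + ycoord \<mu> i)}"

text \<open>The sum for a down step of height \<open>m\<close> runs over its labels, each shifted
  down by one.\<close>

definition step_weight :: "step \<Rightarrow> nat \<Rightarrow> int poly" where
  "step_weight s m = (if s = Down then \<Sum>j<m. qpow j else qpow m)"

definition path_weight :: "nat \<Rightarrow> step list \<Rightarrow> int poly" where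
  "path_weight h \<mu> =
     (\<Prod>i<length \<mu>. step_weight (\<mu> ! i) (nat (int h + max (ycoord \<mu> i) (ycoord \<mu> (Suc i)))))"

lemma ycoord_simps [simp]: "ycoord \<mu> 0 = 0" "ycoord (s # \<mu>) (Suc i) = step_dy s + ycoord \<mu> i"
  by (simp_all add: ycoord_def)

lemma path_weight_Cons:
  assumes "int h' = int h + step_dy s"
  shows "path_weight h (s # \<mu>) = step_weight s (max h h') * path_weight h' \<mu>"
proof -
  have "nat (int h + max 0 (step_dy s)) = max h h'"
    using assms by (auto simp: max_def)
  moreover have "int h + max (step_dy s + a) (step_dy s + b) = int h' + max a b" for a b
    using assms by simp
  ultimately show ?thesis
    unfolding path_weight_def by (simp add: prod.lessThan_Suc_shift del: prod.lessThan_Suc)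
qed

lemma paths_from_Suc_Cons:
  assumes "int h' = int h + step_dy s"
  shows "s # \<mu> \<in> paths_from (Suc n) h \<longleftrightarrow> \<mu> \<in> paths_from n h'"
proof -
  have "(\<forall>i\<le>Suc n. 0 \<le> int h + ycoord (s # \<mu>) i) \<longleftrightarrow> (\<forall>i\<le>n. 0 \<le> int h' + ycoord \<mu> i)"
    unfolding All_less_Suc2[of "Suc n", simplified less_Suc_eq_le] assms by (simp add: add.assoc)
  then show ?thesis
    using assms by (auto simp: paths_from_def)
qed

lemma finite_paths_from [simp]: "finite (paths_from n h)"
proof (rule finite_subset)
  have "s \<in> {Up, Down, Level}" for s by (cases s) auto
  then show "paths_from n h \<subseteq> {\<mu>. set \<mu> \<subseteq> {Up, Down, Level} \<and> length \<mu> = n}"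
    by (auto simp: paths_from_def)
qed (simp add: finite_lists_length_eq)

text \<open>Sorting paths by their first step reproduces the three terms of the recursion.\<close>

lemma sum_path_weight: "(\<Sum>\<mu>\<in>paths_from n h. path_weight h \<mu>) = motzkin_gf n h"
proof (induction n arbitrary: h)
  case 0
  have "paths_from 0 h = (if h = 0 then {[]} else {})"
    by (auto simp: paths_from_def)
  then show ?case by (simp add: path_weight_def)
next
  case (Suc n)
  define P where "P s = {\<mu>. s # \<mu> \<in> paths_from (Suc n) h}" for s
  have sum_Cons: "(\<Sum>\<mu>\<in>(#) s ` P s. path_weight h \<mu>) = step_weight s (max h h') * motzkin_gf n h'"
    if "int h' = int h + step_dy s" for s h'
  proof -
    have "P s = paths_from n h'" by (auto simp: P_def paths_from_Suc_Cons[OF that])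
    then show ?thesis
      by (simp add: sum.reindex path_weight_Cons[OF that] flip: sum_distrib_left Suc.IH)
  qed
  have fin: "finite ((#) s ` P s)" for s
    by (rule finite_subset[OF _ finite_paths_from[of "Suc n" h]]) (auto simp: P_def)
  have down: "(\<Sum>\<mu>\<in>(#) Down ` P Down. path_weight h \<mu>) = (\<Sum>j<h. qpow j) * motzkin_gf n (h - 1)"
  proof (cases h)
    case 0
    \<comment> \<open>From height 0 a down step already violates nonnegativity at index 1.\<close>
    have "P Down = {}"
      using 0 by (auto simp: P_def paths_from_def dest: spec[of _ "Suc 0"])
    then show ?thesis using 0 by simp
  next
    case (Suc h')
    then show ?thesis using sum_Cons[of h' Down] by (simp add: step_weight_def)
  qed
  have "paths_from (Suc n) h = (#) Up ` P Up \<union> (#) Level ` P Level \<union> (#) Down ` P Down"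
  proof (intro equalityI subsetI)
    fix \<mu> assume "\<mu> \<in> paths_from (Suc n) h"
    moreover then obtain s \<nu> where "\<mu> = s # \<nu>"
      by (auto simp: paths_from_def length_Suc_conv)
    ultimately show "\<mu> \<in> (#) Up ` P Up \<union> (#) Level ` P Level \<union> (#) Down ` P Down"
      by (cases s) (auto simp: P_def)
  qed (auto simp: P_def)
  then have "(\<Sum>\<mu>\<in>paths_from (Suc n) h. path_weight h \<mu>)
      = (\<Sum>\<mu>\<in>(#) Up ` P Up. path_weight h \<mu>) + (\<Sum>\<mu>\<in>(#) Level ` P Level. path_weight h \<mu>)
        + (\<Sum>\<mu>\<in>(#) Down ` P Down. path_weight h \<mu>)"
    using fin by (simp only:) (subst sum.union_disjoint; auto)+
  then show ?case
    using sum_Cons[of "Suc h" Up] sum_Cons[of h Level] down by (simp add: step_weight_def)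
qed

section \<open>Passing from labelings to path weights\<close>

lemma qpow_sum: "finite A \<Longrightarrow> qpow (sum f A) = (\<Prod>i\<in>A. qpow (f i))"
proof (induction A rule: finite_induct)
  case (insert x F)
  then show ?case using mult_monom[of "1 :: int" "f x" 1 "sum f F"] by simp
qed simp

text \<open>Labels of different down steps are chosen independently, so the sum over labelings of a
  product factors into a product over steps of sums over labels.\<close>

lemma H_gf_eq_path_weight: "H_gf \<mu> = path_weight 0 \<mu>"
proof -
  let ?n = "length \<mu>"
  define D where "D = {i \<in> {1..?n}. \<mu> ! (i - 1) = Down}"
  define E where "E = {i \<in> {1..?n}. \<mu> ! (i - 1) \<noteq> Down}"
  have split: "prod g {1..?n} = prod g D * prod g E" for g :: "nat \<Rightarrow> int poly"
    unfolding D_def E_def by (subst prod.union_disjoint[symmetric]) (auto intro: prod.cong)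
  have fin: "finite D" "finite E" by (simp_all add: D_def E_def)
  have wt: "(\<Sum>l\<in>{1..step_height \<mu> i}. qpow (l - 1)) = step_weight (\<mu> ! (i - 1)) (step_height \<mu> i)"
    if "i \<in> D" for i
    using that by (simp add: D_def step_weight_def sum.atLeast1_atMost_eq)
  have "H_gf \<mu> = (\<Sum>lab\<in>labelings \<mu>. \<Prod>i\<in>{1..?n}. qpow (H_step \<mu> lab i))"
    by (simp add: H_gf_def H_total_def qpow_sum)
  also have "\<dots> = (\<Sum>lab\<in>labelings \<mu>. (\<Prod>i\<in>D. qpow (lab i - 1)) * (\<Prod>i\<in>E. qpow (step_height \<mu> i)))"
    unfolding split by (simp add: D_def E_def H_step_def)
  also have "\<dots> = (\<Prod>i\<in>D. \<Sum>l\<in>{1..step_height \<mu> i}. qpow (l - 1)) * (\<Prod>i\<in>E. qpow (step_height \<mu> i))"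
    unfolding labelings_def D_def[symmetric]
    by (subst prod_sum_PiE) (simp_all add: fin sum_distrib_right)
  also have "\<dots> = (\<Prod>i\<in>{1..?n}. step_weight (\<mu> ! (i - 1)) (step_height \<mu> i))"
    unfolding split using wt by (simp add: E_def step_weight_def)
  also have "\<dots> = path_weight 0 \<mu>"
    by (simp add: path_weight_def step_height_def prod.atLeast1_atMost_eq)
  finally show ?thesis .
qed

lemma sum_H_gf: "(\<Sum>\<mu>\<in>motzkin_paths n. H_gf \<mu>) = motzkin_gf n 0"
proof -
  have "motzkin_paths n = paths_from n 0"
    by (simp add: motzkin_paths_def paths_from_def)
  then show ?thesis
    using sum_path_weight[of 0 n] by (simp add: H_gf_eq_path_weight)
qed

section \<open>Decomposition of involutions\<close>

definition rank_sum :: "nat \<Rightarrow> (nat \<Rightarrow> nat) set \<Rightarrow> int poly" where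
  "rank_sum N W = (\<Sum>w\<in>W. qpow (inv_rank N w))"

definition open_invs :: "nat \<Rightarrow> nat \<Rightarrow> (nat \<Rightarrow> nat) set" where
  "open_invs h N = {w \<in> involutions N. \<forall>i\<in>{1..h}. h < w i}"

text \<open>For \<open>j = m\<close> the arc \<open>(j, m)\<close> degenerates to a fixed point.\<close>

definition arc_invs :: "nat \<Rightarrow> nat \<Rightarrow> nat \<Rightarrow> nat \<Rightarrow> (nat \<Rightarrow> nat) set" where
  "arc_invs h N j m =
     {w \<in> involutions N. w j = m \<and> (\<forall>i\<in>{1..Suc h} - {j, m}. Suc h < w i)}"

lemma finite_open_invs [simp]: "finite (open_invs h N)"
  by (simp add: open_invs_def)

lemma finite_arc_invs [simp]: "finite (arc_invs h N j m)"
  by (simp add: arc_invs_def)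

section \<open>Sliding a fixed point or an arc to the far left\<close>

lemma conj_adj_arc_invs:
  assumes k: "1 \<le> k" "k \<le> h" "h < N" and w: "w \<in> arc_invs h N j m"
  shows "adj k \<circ> w \<circ> adj k \<in> arc_invs h N (adj k j) (adj k m)"
proof -
  have "Suc h < (adj k \<circ> w \<circ> adj k) i" if i: "i \<in> {1..Suc h} - {adj k j, adj k m}" for i
  proof -
    have "adj k i \<in> {1..Suc h}"
      using i k by (intro transpose_in_Icc) auto
    moreover have "adj k i \<noteq> j" "adj k i \<noteq> m"
      using i by (metis Diff_iff insertI1 insert_iff transpose_involutory)+
    ultimately have "Suc h < w (adj k i)"
      using w by (auto simp: arc_invs_def)
    then show ?thesis using k by simp
  qed
  then show ?thesis
    using w k by (simp add: arc_invs_def conj_adj_involutions)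
qed

text \<open>\<open>Suc k\<close> is an end of the distinguished arc, so its image is at most
  \<open>Suc h\<close>, while \<open>k\<close> is matched beyond \<open>Suc h\<close>. Thus
  \<open>k\<close> is a descent with \<open>w k \<noteq> Suc k\<close>, and conjugation is
  \<open>inv_down\<close>, which lowers the rank by one.\<close>

lemma rank_sum_arc_invs_step:
  assumes k: "1 \<le> k" "k \<le> h" "h < N"
    and jm: "Suc k \<in> {j, m}" "k \<notin> {j, m}" "j \<le> Suc h" "m \<le> Suc h"
  shows "rank_sum N (arc_invs h N j m) = qpow 1 * rank_sum N (arc_invs h N (adj k j) (adj k m))"
proof -
  let ?c = "\<lambda>w. adj k \<circ> w \<circ> adj k"
  have rank: "inv_rank N w = Suc (inv_rank N (?c w))" if w: "w \<in> arc_invs h N j m" for w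
  proof -
    have inv: "w \<in> involutions N" "w j = m" using w by (auto simp: arc_invs_def)
    have "w (Suc k) \<le> Suc h"
      using jm inv involutionsD(2)[OF inv(1), of j] by auto
    moreover have "Suc h < w k"
      using w jm k by (auto simp: arc_invs_def)
    ultimately have "w (Suc k) < w k" "inv_down k w = ?c w"
      using k by (auto simp: inv_down_def)
    then show ?thesis
      using inv_rank_inv_down[of k N w] k inv(1) by simp
  qed
  show ?thesis
    unfolding rank_sum_def sum_distrib_left
  proof (rule sum.reindex_bij_witness[of _ ?c ?c])
    fix w assume "w \<in> arc_invs h N (adj k j) (adj k m)"
    then show "?c w \<in> arc_invs h N j m"
      using conj_adj_arc_invs[OF k, of w "adj k j" "adj k m"] by simp
  qed (simp_all add: conj_adj_arc_invs[OF k] rank mult_monom fun_eq_iff)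
qed

lemma rank_sum_fixed_point:
  assumes "m \<le> h" "h < N"
  shows "rank_sum N (arc_invs h N (Suc m) (Suc m)) = qpow m * rank_sum N (arc_invs h N 1 1)"
  using assms(1)
proof (induction m)
  case (Suc m)
  then show ?case
    using rank_sum_arc_invs_step[of "Suc m" h N "Suc (Suc m)" "Suc (Suc m)"] assms(2)
    by (simp add: mult_monom flip: mult.assoc)
qed (simp flip: one_pCons)

text \<open>The left end moves first, in \<open>j\<close> steps to 1; then the right end moves from
  \<open>Suc h\<close> to 2 in \<open>h - 1\<close> steps. In this order the two ends never
  meet.\<close>

lemma rank_sum_arc:
  assumes "j < h" "h < N"
  shows "rank_sum N (arc_invs h N (Suc j) (Suc h)) = qpow (j + h - 1) * rank_sum N (arc_invs h N 1 2)"
proof -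
  have left: "rank_sum N (arc_invs h N (Suc j) (Suc h)) = qpow j * rank_sum N (arc_invs h N 1 (Suc h))"
    using assms(1)
  proof (induction j)
    case (Suc j)
    then show ?case
      using rank_sum_arc_invs_step[of "Suc j" h N "Suc (Suc j)" "Suc h"] assms(2)
      by (simp add: mult_monom flip: mult.assoc)
  qed (simp flip: one_pCons)
  have right: "rank_sum N (arc_invs h N 1 (Suc (Suc m))) = qpow m * rank_sum N (arc_invs h N 1 2)"
    if "Suc m \<le> h" for m
    using that
  proof (induction m)
    case (Suc m)
    then show ?case
      using rank_sum_arc_invs_step[of "Suc (Suc m)" h N 1 "Suc (Suc (Suc m))"] assms(2)
      by (simp add: mult_monom flip: mult.assoc)
  qed (simp add: numeral_2_eq_2 flip: one_pCons)
  obtain h' where "h = Suc h'" using assms(1) by (cases h) auto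
  then show ?thesis
    using left right[of h'] by (simp add: mult_monom flip: mult.assoc)
qed

section \<open>Removing the leftmost fixed point or arc\<close>

definition shift_perm :: "(nat \<Rightarrow> nat) \<Rightarrow> nat \<Rightarrow> nat" where
  "shift_perm v i = (case i of 0 \<Rightarrow> 0 | Suc i' \<Rightarrow> Suc (v i'))"

definition unshift_perm :: "(nat \<Rightarrow> nat) \<Rightarrow> nat \<Rightarrow> nat" where
  "unshift_perm w i = w (Suc i) - 1"

lemma shift_perm_simps [simp]: "shift_perm v 0 = 0" "shift_perm v (Suc i) = Suc (v i)"
  by (simp_all add: shift_perm_def)

lemma unshift_shift_perm [simp]: "unshift_perm (shift_perm v) = v"
  by (simp add: unshift_perm_def fun_eq_iff)

text \<open>Bijectivity is implied by \<open>p (p i) = i\<close>, so only the values outside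
  \<open>{1..n}\<close> remain to be checked.\<close>

lemma involutions_iff':
  "p \<in> involutions n \<longleftrightarrow> (\<forall>i. p (p i) = i) \<and> p 0 = 0 \<and> (\<forall>i>n. p i = i)"
  unfolding involutions_iff permutes_def
  by (auto simp: not_le) (metis not_less_eq_eq not_le_imp_less le_zero_eq)+

lemma involutions_0: "p \<in> involutions n \<Longrightarrow> p 0 = 0"
  by (simp add: involutions_iff')

lemma shift_perm_involutions: "v \<in> involutions N \<Longrightarrow> shift_perm v \<in> involutions (Suc N)"
  by (auto simp: involutions_iff' shift_perm_def split: nat.splits)

lemma shift_unshift_perm:
  assumes "w \<in> involutions N" "w 1 = 1"
  shows "shift_perm (unshift_perm w) = w"
proof
  fix i
  have "w (Suc j) \<noteq> 0" for j
    using assms(1) by (metis involutions_iff' nat.distinct(1))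
  then show "shift_perm (unshift_perm w) i = w i"
    using assms(1) by (cases i) (auto simp: unshift_perm_def involutions_0)
qed

lemma unshift_perm_involutions:
  assumes "w \<in> involutions (Suc N)" "w 1 = 1"
  shows "unshift_perm w \<in> involutions N"
proof -
  define v where "v = unshift_perm w"
  have w: "w = shift_perm v"
    using shift_unshift_perm[OF assms] by (simp add: v_def)
  have "v (v i) = i" for i
    using involutionsD(2)[OF assms(1), of "Suc i"] by (simp add: w)
  moreover have "v i = i" if "i > N" for i
    using assms(1) that unfolding involutions_iff' w by (auto dest: spec[of _ "Suc i"])
  moreover have "v 0 = 0" using assms(2) by (simp add: w)
  ultimately show ?thesis by (simp add: involutions_iff' v_def)
qed

text \<open>Since \<open>v 0 = 0\<close>, shifting prepends the fixed point 1. It takes part in no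
  inversion and is no exceedance; all others are translated by one.\<close>

lemma inv_rank_shift_perm:
  assumes "v \<in> involutions N"
  shows "inv_rank (Suc N) (shift_perm v) = inv_rank N v"
proof -
  note v0 = involutions_0[OF assms]
  have "Inv (Suc N) (shift_perm v) = map_prod Suc Suc ` Inv N v"
  proof (intro equalityI subsetI)
    fix x assume "x \<in> Inv (Suc N) (shift_perm v)"
    then obtain a b where ab: "x = (a, b)" "1 \<le> a" "a < b" "b \<le> Suc N" "shift_perm v b < shift_perm v a"
      by (auto simp: Inv_def)
    then obtain a' b' where eq: "a = Suc a'" "b = Suc b'"
      by (cases a; cases b) auto
    have "a' \<noteq> 0" using ab v0 by (cases a') (auto simp: eq)
    then have "(a', b') \<in> Inv N v" using ab by (simp add: Inv_def eq)
    then show "x \<in> map_prod Suc Suc ` Inv N v" by (auto simp: ab eq)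
  qed (auto simp: Inv_def)
  moreover have "inj (map_prod Suc Suc)" by (intro prod.inj_map) simp_all
  ultimately have len: "perm_length (Suc N) (shift_perm v) = perm_length N v"
    by (simp add: perm_length_def card_image inj_on_subset)
  have "{i \<in> {1..Suc N}. i < shift_perm v i} = Suc ` {i \<in> {1..N}. i < v i}"
  proof (intro equalityI subsetI)
    fix i assume i: "i \<in> {i \<in> {1..Suc N}. i < shift_perm v i}"
    then obtain i' where eq: "i = Suc i'" by (cases i) auto
    then have "i' \<noteq> 0" using i v0 by (cases i') auto
    then show "i \<in> Suc ` {i \<in> {1..N}. i < v i}" using i by (simp add: eq image_iff)
  qed auto
  then show ?thesis by (simp add: inv_rank_def len card_image)
qed

lemma rank_sum_fixed_one: "rank_sum (Suc N) (arc_invs h (Suc N) 1 1) = rank_sum N (open_invs h N)"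
  unfolding rank_sum_def
proof (rule sym, rule sum.reindex_bij_witness[of _ unshift_perm shift_perm])
  fix v assume "v \<in> open_invs h N"
  then have v: "v \<in> involutions N" and gt: "\<And>i. \<lbrakk>1 \<le> i; i \<le> h\<rbrakk> \<Longrightarrow> h < v i"
    by (auto simp: open_invs_def)
  show "qpow (inv_rank (Suc N) (shift_perm v)) = qpow (inv_rank N v)"
    by (simp add: inv_rank_shift_perm[OF v])
  have "Suc h < shift_perm v i" if "i \<in> {1..Suc h} - {1, 1}" for i
    using that gt[of "i - 1"] by (cases i) auto
  then show "shift_perm v \<in> arc_invs h (Suc N) 1 1"
    using shift_perm_involutions[OF v] involutions_0[OF v] by (simp add: arc_invs_def)
  show "unshift_perm (shift_perm v) = v" by simp
next
  fix w assume "w \<in> arc_invs h (Suc N) 1 1"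
  then have w: "w \<in> involutions (Suc N)" "w 1 = 1"
    and gt: "\<And>i. \<lbrakk>2 \<le> i; i \<le> Suc h\<rbrakk> \<Longrightarrow> Suc h < w i"
    by (auto simp: arc_invs_def)
  show "shift_perm (unshift_perm w) = w" by (rule shift_unshift_perm[OF w])
  have "h < unshift_perm w i" if "1 \<le> i" "i \<le> h" for i
    using that gt[of "Suc i"] by (simp add: unshift_perm_def)
  then show "unshift_perm w \<in> open_invs h N"
    using unshift_perm_involutions[OF w] by (simp add: open_invs_def)
qed

text \<open>Prepending two fixed points keeps the rank, and joining them by \<open>adj 1\<close> is
  an instance of \<open>inv_up\<close>, which adds one. The arc uses two of the first
  \<open>h + 2\<close> points, so \<open>h\<close> open points remain.\<close>

lemma rank_sum_arc_one_two:
  "rank_sum (Suc (Suc N)) (arc_invs (Suc h) (Suc (Suc N)) 1 2) = qpow 1 * rank_sum N (open_invs h N)"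
proof -
  let ?N = "Suc (Suc N)"
  let ?i = "\<lambda>v. shift_perm (shift_perm v) \<circ> adj 1"
  let ?r = "\<lambda>w. unshift_perm (unshift_perm (w \<circ> adj 1))"
  have "(\<Sum>v\<in>open_invs h N. qpow 1 * qpow (inv_rank N v))
      = (\<Sum>w\<in>arc_invs (Suc h) ?N 1 2. qpow (inv_rank ?N w))"
  proof (rule sum.reindex_bij_witness[of _ ?r ?i])
    fix v assume "v \<in> open_invs h N"
    then have v: "v \<in> involutions N" and gt: "\<And>i. \<lbrakk>1 \<le> i; i \<le> h\<rbrakk> \<Longrightarrow> h < v i"
      by (auto simp: open_invs_def)
    let ?s = "shift_perm (shift_perm v)"
    note s = shift_perm_involutions[OF shift_perm_involutions[OF v]]
    have fixed: "?s 1 = 1" "?s (Suc 1) = Suc 1"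
      using involutions_0[OF v] by simp_all
    then have up: "inv_up 1 ?s = ?i v" by (simp add: inv_up_def)
    have "inv_rank ?N (?i v) = Suc (inv_rank N v)"
      using inv_rank_inv_up[of 1 ?N ?s] s fixed
        inv_rank_shift_perm[OF v] inv_rank_shift_perm[OF shift_perm_involutions[OF v]]
      by (simp add: up del: One_nat_def)
    then show "qpow (inv_rank ?N (?i v)) = qpow 1 * qpow (inv_rank N v)"
      by (simp add: mult_monom)
    have "?i v \<in> involutions ?N"
      using inv_up_involutions[of 1 ?N ?s] s by (simp add: up del: One_nat_def)
    moreover have "Suc (Suc h) < ?i v i" if "i \<in> {1..Suc (Suc h)} - {1, 2}" for i
    proof -
      have "i = Suc (Suc (i - 2))" "1 \<le> i - 2" "i - 2 \<le> h" using that by auto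
      moreover have "?i v (Suc (Suc i')) = Suc (Suc (v i'))" if "1 \<le> i'" for i'
        using that by simp
      ultimately show ?thesis using gt[of "i - 2"] by (metis Suc_less_eq)
    qed
    ultimately show "?i v \<in> arc_invs (Suc h) ?N 1 2"
      using fixed by (simp add: arc_invs_def numeral_2_eq_2)
    show "?r (?i v) = v" by (simp add: comp_assoc)
  next
    fix w assume "w \<in> arc_invs (Suc h) ?N 1 2"
    then have w: "w \<in> involutions ?N" "w 1 = 2"
      and gt: "\<And>i. \<lbrakk>3 \<le> i; i \<le> Suc (Suc h)\<rbrakk> \<Longrightarrow> Suc (Suc h) < w i"
      by (auto simp: arc_invs_def)
    let ?u = "w \<circ> adj 1"
    have u: "?u \<in> involutions ?N"
      using w by (intro comp_adj_involutions) auto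
    have fixed: "?u 1 = 1" "?u 2 = 2"
      using w involutionsD(2)[OF w(1), of 1] by (simp_all add: numeral_2_eq_2)
    note v = unshift_perm_involutions[OF u fixed(1)]
    have v1: "unshift_perm ?u 1 = 1"
      using fixed(2) by (simp add: unshift_perm_def numeral_2_eq_2)
    show "?i (?r w) = w"
      by (simp only: shift_unshift_perm[OF v v1] shift_unshift_perm[OF u fixed(1)] comp_assoc
          transpose_comp_involutory comp_id)
    have "h < ?r w i" if "1 \<le> i" "i \<le> h" for i
      using that gt[of "Suc (Suc i)"] by (simp add: unshift_perm_def)
    then show "?r w \<in> open_invs h N"
      unfolding open_invs_def mem_Collect_eq
      by (intro conjI ballI unshift_perm_involutions[OF v v1]) auto
  qed
  then show ?thesis by (simp add: rank_sum_def sum_distrib_left)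
qed

section \<open>The recursion on the first point after the open ones\<close>

lemma open_invs_split:
  assumes "h < N"
  shows "open_invs h N = open_invs (Suc h) N \<union> arc_invs h N (Suc h) (Suc h)
    \<union> (\<Union>j<h. arc_invs h N (Suc j) (Suc h))" (is "_ = ?R")
proof (intro equalityI subsetI)
  fix w assume "w \<in> open_invs h N"
  then have w: "w \<in> involutions N" and gt: "\<And>i. \<lbrakk>1 \<le> i; i \<le> h\<rbrakk> \<Longrightarrow> h < w i"
    by (auto simp: open_invs_def)
  note ww = involutionsD(2)[OF w]
  \<comment> \<open>Among the first \<open>h\<close> points only the partner of \<open>Suc h\<close>
    can have image \<open>Suc h\<close>.\<close>
  have gt': "Suc h < w i" if "1 \<le> i" "i \<le> h" "i \<noteq> w (Suc h)" for i
    using gt[of i] that ww[of i] by (metis Suc_lessI)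
  consider "Suc h < w (Suc h)" | "w (Suc h) = Suc h" | "w (Suc h) \<le> h" by linarith
  then show "w \<in> ?R"
  proof cases
    case 1
    then have "w \<in> open_invs (Suc h) N"
      using w gt' by (auto simp: open_invs_def le_Suc_eq)
    then show ?thesis by blast
  next
    case 2
    then have "w \<in> arc_invs h N (Suc h) (Suc h)"
      using w gt' by (auto simp: arc_invs_def le_Suc_eq)
    then show ?thesis by blast
  next
    case 3
    moreover have "w (Suc h) \<noteq> 0"
      using ww[of "Suc h"] involutions_0[OF w] by (metis nat.distinct(1))
    ultimately obtain j where j: "w (Suc h) = Suc j" "j < h" by (cases "w (Suc h)") auto
    then have "w \<in> arc_invs h N (Suc j) (Suc h)"
      using w gt' ww[of "Suc h"] by (auto simp: arc_invs_def le_Suc_eq)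
    then show ?thesis using j by blast
  qed
next
  fix w assume "w \<in> ?R"
  then show "w \<in> open_invs h N"
  proof (elim UnE UN_E)
    assume "w \<in> open_invs (Suc h) N"
    then show ?thesis by (auto simp: open_invs_def Suc_lessD)
  next
    assume "w \<in> arc_invs h N (Suc h) (Suc h)"
    then show ?thesis by (auto simp: open_invs_def arc_invs_def Suc_lessD)
  next
    fix j assume w: "w \<in> arc_invs h N (Suc j) (Suc h)"
    have "h < w i" if "1 \<le> i" "i \<le> h" for i
      using that w by (cases "i = Suc j") (auto simp: arc_invs_def Suc_lessD)
    then show ?thesis using w by (auto simp: open_invs_def arc_invs_def)
  qed
qed

text \<open>The value of \<open>w\<close> at \<open>Suc h\<close> tells the pieces apart, so the
  union is disjoint.\<close>

lemma rank_sum_open_invs_split: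
  assumes "h < N"
  shows "rank_sum N (open_invs h N) = rank_sum N (open_invs (Suc h) N)
    + rank_sum N (arc_invs h N (Suc h) (Suc h)) + (\<Sum>j<h. rank_sum N (arc_invs h N (Suc j) (Suc h)))"
proof -
  have arc: "w (Suc h) = Suc j" if "w \<in> arc_invs h N (Suc j) (Suc h)" for w j
    using that involutionsD(2)[of w N "Suc j"] by (auto simp: arc_invs_def)
  have gt: "Suc h < w (Suc h)" if "w \<in> open_invs (Suc h) N" for w
    using that by (auto simp: open_invs_def)
  have "rank_sum N (\<Union>j<h. arc_invs h N (Suc j) (Suc h))
      = (\<Sum>j<h. rank_sum N (arc_invs h N (Suc j) (Suc h)))"
    unfolding rank_sum_def by (rule sum.UNION_disjoint) (auto, metis arc nat.inject)
  moreover have "rank_sum N (A \<union> B) = rank_sum N A + rank_sum N B"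
    if "finite A" "finite B" "A \<inter> B = {}" for A B
    unfolding rank_sum_def using that by (rule sum.union_disjoint)
  moreover have "open_invs (Suc h) N \<inter> arc_invs h N (Suc h) (Suc h) = {}"
    "(open_invs (Suc h) N \<union> arc_invs h N (Suc h) (Suc h)) \<inter> (\<Union>j<h. arc_invs h N (Suc j) (Suc h)) = {}"
    by (auto dest!: arc gt)
  ultimately show ?thesis
    unfolding open_invs_split[OF assms] by simp
qed

text \<open>The prefactor is the weight of the up steps to heights 1 to \<open>h\<close> that opened
  the arcs; \<open>n\<close> counts the points still to be read.\<close>

lemma rank_sum_open_invs:
  "rank_sum (n + h) (open_invs h (n + h)) = qpow (\<Sum>{..h}) * motzkin_gf n h"
proof (induction n arbitrary: h)
  case 0
  show ?case
  proof (cases "h = 0")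
    case True
    have "involutions 0 = {id}"
      by (auto simp: involutions_def)
    then have "open_invs 0 0 = {id}" by (simp add: open_invs_def)
    then show ?thesis using True by (simp add: rank_sum_def)
  next
    case False
    \<comment> \<open>With no points left beyond \<open>h\<close>, point \<open>h\<close> cannot be
      matched there.\<close>
    have "w h \<le> h" if "w \<in> involutions h" for w
      using involutionsD(5)[OF that, of h] False by simp
    then have "open_invs h h = {}"
      using False by (auto simp: open_invs_def Ball_def not_less intro!: exI[of _ h])
    then show ?thesis using False by (simp add: rank_sum_def)
  qed
next
  case (Suc n)
  let ?N = "Suc n + h"
  have up: "rank_sum ?N (open_invs (Suc h) ?N) = qpow (\<Sum>{..h}) * (qpow (Suc h) * motzkin_gf n (Suc h))"
    using Suc.IH[of "Suc h"] by (simp add: mult_monom flip: mult.assoc)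
  have level: "rank_sum ?N (arc_invs h ?N (Suc h) (Suc h)) = qpow (\<Sum>{..h}) * (qpow h * motzkin_gf n h)"
    using rank_sum_fixed_point[of h h ?N] rank_sum_fixed_one[of "n + h" h] Suc.IH[of h]
    by (simp add: ac_simps)
  have down: "(\<Sum>j<h. rank_sum ?N (arc_invs h ?N (Suc j) (Suc h)))
      = qpow (\<Sum>{..h}) * ((\<Sum>j<h. qpow j) * motzkin_gf n (h - 1))"
  proof (cases h)
    case (Suc h')
    \<comment> \<open>Sliding contributes \<open>j + h'\<close> and deleting the arc contributes 1.
      As \<open>h' + 1 = h\<close>, this completes the prefactor for \<open>h'\<close> to the one
      for \<open>h\<close> and leaves \<open>qpow j\<close>.\<close>
    have "rank_sum ?N (arc_invs h ?N (Suc j) (Suc h)) = qpow (\<Sum>{..h}) * qpow j * motzkin_gf n h'"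
      if "j < h" for j
    proof -
      have "rank_sum ?N (arc_invs h ?N (Suc j) (Suc h))
          = qpow (j + h') * (qpow 1 * (qpow (\<Sum>{..h'}) * motzkin_gf n h'))"
        using rank_sum_arc[of j h ?N] that rank_sum_arc_one_two[of "n + h'" h'] Suc.IH[of h']
        by (simp add: Suc)
      then show ?thesis
        by (simp add: Suc mult_monom add_ac flip: mult.assoc)
    qed
    then show ?thesis
      by (simp add: Suc sum_distrib_left sum_distrib_right mult.assoc del: sum.lessThan_Suc)
  qed simp
  show ?case
    using rank_sum_open_invs_split[of h ?N] up level down by (simp add: distrib_left)
qed

theorem theorem1p1:
  fixes n :: nat
  shows "(\<Sum>\<mu>\<in>motzkin_paths n. H_gf \<mu>) = rank_gf (involutions n) (bruhat_le n)"
proof -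
  have "open_invs 0 n = involutions n" by (simp add: open_invs_def)
  then have "rank_gf (involutions n) (bruhat_le n) = motzkin_gf n 0"
    using rank_sum_open_invs[of n 0]
    by (simp add: rank_gf_def rank_sum_def poset_rank_involutions)
  then show ?thesis by (simp add: sum_H_gf)
qed

end
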